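(* Let $0<\ell\le r\le 1$, let $n\ge 1$, and let $A_1,\dots,A_n>0$. Put $A=\sum_{i=1}^n A_i$ and $A_{\max}=\max_{1\le i\le n}A_i$. A scheduling policy is a family $\pi=\{(\tau_i,s_i)\}_{i=1}^n$ of real numbers with $0\le \tau_i\le \tau_i+s_i\le 1$ and $\ell\le s_i\le r$ for all $i$; let $\Pi$ be the set of all scheduling policies. For $\pi\in\Pi$ define $$P^{\pi}(t)=\sum_{i=1}^n \frac{A_i}{s_i}\,\mathbf 1_{\{\tau_i\le t\le \tau_i+s_i\}},\quad t\in[0,1],\qquad P^{\pi}_{\max}=\max_{t\in[0,1]}P^{\pi}(t),$$ and $P_{opt}=\inf_{\pi\in\Pi}P^{\pi}_{\max}$. Say $(\ell,r)\in\mathcal G$ if $\lceil 1/r\rceil\le 1/\ell$, and put $Z^*=r\lfloor 1/r\rfloor$. Define $\overline A=A$ if $(\ell,r)\in\mathcal G$ and $\overline A=A/Z^*$ if $(\ell,r)\notin\mathcal G$. Then $$\overline A\le P_{opt}\le \overline A+\frac{A_{\max}}{\ell}.$$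
   Context: $A_i$ is the energy demand of customer $i$, supplied at constant power $A_i/s_i$ without interruption on $[\tau_i,\tau_i+s_i]$. The condition $\lceil 1/r\rceil\le 1/\ell$ is exactly the condition that $1$ can be written as a sum of finitely many reals each lying in $[\ell,r]$ (the "good region" $\mathcal G$). When $(\ell,r)\notin\mathcal G$ one has $r<1$, so $Z^*>0$.
   Formalization: The upper bound fails for closed intervals if 1/ℓ=⌈1/r⌉ (e.g. ℓ=r=1/2, n=3, A_i=1: P_opt=6>5), so for closed intervals it is proved only when 1/ℓ≠⌈1/r⌉; with jobs occupying [τ_i,τ_i+s_i) both bounds are proved in all cases. *)

theory Defs
  imports Complex_Main "HOL-Library.Indicator_Function"
begin

text \<open>
  Customers are indexed by \<open>{1..n}\<close>; a policy assigns to customer \<open>i\<close> the pair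
  \<open>(\<tau>\<^sub>i, s\<^sub>i)\<close>, and its values outside \<open>{1..n}\<close> are irrelevant.
\<close>

definition policies :: "real \<Rightarrow> real \<Rightarrow> nat \<Rightarrow> (nat \<Rightarrow> real \<times> real) set" where
  "policies l r n = {\<pi>. \<forall>i\<in>{1..n}. case \<pi> i of (\<tau>, s) \<Rightarrow>
     0 \<le> \<tau> \<and> \<tau> \<le> \<tau> + s \<and> \<tau> + s \<le> 1 \<and> l \<le> s \<and> s \<le> r}"

text \<open>
  The parameter \<open>J\<close> is the convention for the time interval occupied by a job:
  \<open>atLeastAtMost\<close> gives \<open>{\<tau>..\<tau>+s}\<close>, \<open>atLeastLessThan\<close> gives \<open>{\<tau>..<\<tau>+s}\<close>.
  The choice matters only when one job starts at the instant another one ends: with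
  closed intervals both are counted at that instant.
\<close>

definition total_power ::
  "(real \<Rightarrow> real \<Rightarrow> real set) \<Rightarrow> nat \<Rightarrow> (nat \<Rightarrow> real) \<Rightarrow> (nat \<Rightarrow> real \<times> real) \<Rightarrow> real \<Rightarrow> real" where
  "total_power J n A \<pi> t =
     (\<Sum>i=1..n. case \<pi> i of (\<tau>, s) \<Rightarrow> A i / s * indicator (J \<tau> (\<tau> + s)) t)"

definition peak_power ::
  "(real \<Rightarrow> real \<Rightarrow> real set) \<Rightarrow> nat \<Rightarrow> (nat \<Rightarrow> real) \<Rightarrow> (nat \<Rightarrow> real \<times> real) \<Rightarrow> real" where
  "peak_power J n A \<pi> = Max (total_power J n A \<pi> ` {0..1})"

definition P_opt ::
  "(real \<Rightarrow> real \<Rightarrow> real set) \<Rightarrow> real \<Rightarrow> real \<Rightarrow> nat \<Rightarrow> (nat \<Rightarrow> real) \<Rightarrow> real" where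
  "P_opt J l r n A = (INF \<pi>\<in>policies l r n. peak_power J n A \<pi>)"

definition good_region :: "(real \<times> real) set" where
  "good_region = {(l, r). real_of_int \<lceil>1 / r\<rceil> \<le> 1 / l}"

definition Z_star :: "real \<Rightarrow> real" where
  "Z_star r = r * real_of_int \<lfloor>1 / r\<rfloor>"

definition A_bar :: "real \<Rightarrow> real \<Rightarrow> nat \<Rightarrow> (nat \<Rightarrow> real) \<Rightarrow> real" where
  "A_bar l r n A =
     (if (l, r) \<in> good_region then (\<Sum>i=1..n. A i) else (\<Sum>i=1..n. A i) / Z_star r)"

definition A_max :: "nat \<Rightarrow> (nat \<Rightarrow> real) \<Rightarrow> real" where
  "A_max n A = Max (A ` {1..n})"

text \<open>The maximum in \<open>peak_power\<close> is over a finite set, and the infimum in \<open>P_opt\<close> is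
  over a nonempty set that is bounded below.\<close>

lemma finite_total_power_image: "finite (total_power J n A \<pi> ` T)"
proof -
  let ?on = "\<lambda>t. {i\<in>{1..n}. t \<in> J (fst (\<pi> i)) (fst (\<pi> i) + snd (\<pi> i))}"
  have eq: "total_power J n A \<pi> t = (\<Sum>i\<in>?on t. A i / snd (\<pi> i))" for t
    unfolding total_power_def
    by (subst sum.inter_filter)
       (auto simp: indicator_def case_prod_unfold intro!: sum.cong)
  have "total_power J n A \<pi> ` T \<subseteq> (\<lambda>S. \<Sum>i\<in>S. A i / snd (\<pi> i)) ` Pow {1..n}"
    unfolding eq by auto
  then show ?thesis
    by (rule finite_subset) simp
qed

lemma total_power_le_peak_power:
  assumes "0 \<le> t" "t \<le> 1"
  shows "total_power J n A \<pi> t \<le> peak_power J n A \<pi>"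
  unfolding peak_power_def using assms by (intro Max_ge finite_total_power_image) auto

lemma policies_nonempty:
  assumes "0 < l" "l \<le> r" "r \<le> 1"
  shows "policies l r n \<noteq> {}"
proof -
  have "(\<lambda>_. (0, l)) \<in> policies l r n"
    using assms by (auto simp: policies_def)
  then show ?thesis by blast
qed

lemma bdd_below_peak_power:
  assumes "0 < l" "\<And>i. i \<in> {1..n} \<Longrightarrow> 0 < A i"
  shows "bdd_below (peak_power J n A ` policies l r n)"
proof (rule bdd_belowI2)
  fix \<pi> assume \<pi>: "\<pi> \<in> policies l r n"
  have "0 \<le> total_power J n A \<pi> 0"
    unfolding total_power_def
  proof (rule sum_nonneg)
    fix i assume i: "i \<in> {1..n}"
    then have "0 < A i" "l \<le> snd (\<pi> i)"
      using assms(2) \<pi> by (auto simp: policies_def case_prod_unfold)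
    then show "0 \<le> (case \<pi> i of (\<tau>, s) \<Rightarrow> A i / s * indicator (J \<tau> (\<tau> + s)) 0)"
      using assms(1) by (auto simp: case_prod_unfold)
  qed
  also have "\<dots> \<le> peak_power J n A \<pi>"
    by (rule total_power_le_peak_power) auto
  finally show "0 \<le> peak_power J n A \<pi>" .
qed

text \<open>
  With closed intervals the upper bound \<open>P_opt \<le> A_bar + A_max / l\<close> can fail when
  \<open>1 / l = \<lceil>1 / r\<rceil>\<close>. For \<open>l = r = 1/2\<close> every closed job interval contains
  the time \<open>1/2\<close>, so three unit demands force the peak \<open>6 > 3 + 2\<close>.
\<close>

lemma closed_upper_bound_fails:
  fixes l r :: real and A :: "nat \<Rightarrow> real"
  defines "l \<equiv> 1 / 2" and "r \<equiv> 1 / 2" and "A \<equiv> \<lambda>_. 1"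
  shows "\<not> P_opt atLeastAtMost l r 3 A \<le> A_bar l r 3 A + A_max 3 A / l"
proof -
  have "6 \<le> P_opt atLeastAtMost l r 3 A"
    unfolding P_opt_def
  proof (rule cINF_greatest)
    show "policies l r 3 \<noteq> {}"
      by (rule policies_nonempty) (auto simp: l_def r_def)
  next
    fix \<pi> assume \<pi>: "\<pi> \<in> policies l r 3"
    have "(case \<pi> i of (\<tau>, s) \<Rightarrow> A i / s * indicator {\<tau>..\<tau> + s} (1/2)) = 2"
      if "i \<in> {1..3}" for i
    proof -
      obtain \<tau> s where \<pi>i: "\<pi> i = (\<tau>, s)" by fastforce
      with \<pi> that have "0 \<le> \<tau>" "\<tau> + s \<le> 1" and s: "s = 1 / 2"
        unfolding policies_def l_def r_def by fastforce+
      then show ?thesis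
        by (auto simp: \<pi>i A_def indicator_def s)
    qed
    then have "total_power atLeastAtMost 3 A \<pi> (1/2) = 6"
      by (simp add: total_power_def)
    then show "6 \<le> peak_power atLeastAtMost 3 A \<pi>"
      using total_power_le_peak_power[of "1/2" atLeastAtMost 3 A \<pi>] by simp
  qed
  moreover have "A_bar l r 3 A = 3" "A_max 3 A = 1"
    by (auto simp: A_bar_def good_region_def A_max_def A_def l_def r_def)
  ultimately show ?thesis
    by (simp add: l_def)
qed

end

theory Submission
  imports Defs "HOL-Analysis.Henstock_Kurzweil_Integration"
begin

text \<open>
  Upper bound: divide \<open>[0,1]\<close> into \<open>k\<close> equal slots, let every job run for a time
  \<open>s \<le> 1/k\<close> from the start of a slot, and assign the jobs greedily, each to a currently
  least loaded slot. No slot then gets more than \<open>A/k + A_max\<close>, so the peak is at most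
  \<open>A/(k s) + A_max/s\<close>. In the good region take \<open>k = \<lceil>1/r\<rceil>\<close> and \<open>s = 1/k\<close>,
  otherwise \<open>k = \<lfloor>1/r\<rfloor>\<close> and \<open>s = r\<close>. With closed intervals the slots must not
  touch, so in the good region \<open>s\<close> only tends to \<open>1/k\<close> from below.

  Lower bound: in the good region, the peak is at least the integral of the power. Otherwise
  \<open>l > 1/(m+1)\<close> for \<open>m = \<lfloor>1/r\<rfloor>\<close>, so every job is running at one of the \<open>m\<close> times
  \<open>j/(m+1)\<close>, \<open>1 \<le> j \<le> m\<close>, and the average power over these times is at least
  \<open>A/(m r)\<close>.
\<close>

section \<open>Feasible policies and greedy balancing of the demands\<close>

lemma policiesD:
  assumes "\<pi> \<in> policies l r n" "i \<in> {1..n}"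
  shows "0 \<le> fst (\<pi> i)" "fst (\<pi> i) + snd (\<pi> i) \<le> 1" "l \<le> snd (\<pi> i)" "snd (\<pi> i) \<le> r"
  using assms by (auto simp: policies_def case_prod_unfold)

lemma exists_sum_le_average:
  fixes g :: "'a \<Rightarrow> real"
  assumes "finite S" "S \<noteq> {}"
  shows "\<exists>x\<in>S. g x \<le> sum g S / card S"
proof (rule ccontr)
  assume "\<not> ?thesis"
  then have "(\<Sum>x\<in>S. sum g S / card S) < sum g S"
    using assms by (intro sum_strict_mono) auto
  then show False
    using assms by simp
qed

text \<open>Induction on \<open>S\<close>: the new element joins a class whose load is at most the
  current average, so that class exceeds the average by at most \<open>M\<close>; all other classes
  keep their load.\<close>

lemma greedy_balanced_partition:
  fixes A :: "'a \<Rightarrow> real" and k :: nat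
  assumes "finite S" "0 < k" "0 \<le> M" "\<And>i. i \<in> S \<Longrightarrow> 0 \<le> A i" "\<And>i. i \<in> S \<Longrightarrow> A i \<le> M"
  shows "\<exists>f. (\<forall>i\<in>S. f i < k) \<and> (\<forall>j<k. (\<Sum>i\<in>{i\<in>S. f i = j}. A i) \<le> sum A S / k + M)"
  using assms(1,4,5)
proof (induction S)
  case empty
  then show ?case using \<open>0 \<le> M\<close> by simp
next
  case (insert x S)
  then obtain f where f: "\<forall>i\<in>S. f i < k"
    and load: "\<And>j. j < k \<Longrightarrow> (\<Sum>i\<in>{i\<in>S. f i = j}. A i) \<le> sum A S / k + M"
    by auto
  define L where "L j = (\<Sum>i\<in>{i\<in>S. f i = j}. A i)" for j
  have total: "(\<Sum>j<k. L j) = sum A S"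
    unfolding L_def using f \<open>finite S\<close> by (intro sum.group) auto
  obtain j0 where j0: "j0 < k" "L j0 \<le> sum A S / k"
    using exists_sum_le_average[of "{..<k}" L] \<open>0 < k\<close> total by auto
  define g where "g = f(x := j0)"
  have old: "{i\<in>insert x S. g i = j} = (if j = j0 then insert x else id) {i\<in>S. f i = j}" for j
    using \<open>x \<notin> S\<close> by (auto simp: g_def)
  \<comment> \<open>Since \<open>A x\<close> is nonnegative, the average only grows, so bounds in
    terms of the old average remain usable.\<close>
  have avg: "sum A S / k \<le> sum A (insert x S) / k"
    using insert by (intro divide_right_mono) auto
  have "(\<Sum>i\<in>{i\<in>insert x S. g i = j}. A i) \<le> sum A (insert x S) / k + M" if "j < k" for j
  proof (cases "j = j0")
    case True
    have "(\<Sum>i\<in>{i\<in>insert x S. g i = j}. A i) = A x + L j0"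
      using True insert.hyps unfolding old L_def by simp
    also have "\<dots> \<le> M + sum A S / k"
      using j0 insert.prems(2)[of x] by simp
    finally show ?thesis
      using avg by linarith
  next
    case False
    then have "(\<Sum>i\<in>{i\<in>insert x S. g i = j}. A i) = (\<Sum>i\<in>{i\<in>S. f i = j}. A i)"
      unfolding old by simp
    then show ?thesis
      using load[OF that] avg by linarith
  qed
  moreover have "\<forall>i\<in>insert x S. g i < k"
    using f j0 by (auto simp: g_def)
  ultimately show ?case
    by blast
qed

section \<open>Upper bound from slot schedules\<close>

text \<open>All jobs of one slot run simultaneously with the same length \<open>s\<close>, so the
  peak is the largest slot load divided by \<open>s\<close>. The assumption \<open>disj\<close>
  isolates the only property of the convention \<open>J\<close> that matters: no instant belongs to
  two slots.\<close>

lemma P_opt_le_slots: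
  fixes k :: nat and s :: real
  assumes "0 < l" "1 \<le> n" and A: "\<And>i. i \<in> {1..n} \<Longrightarrow> 0 < A i"
    and k: "0 < k" "s \<le> 1 / k" and s: "l \<le> s" "s \<le> r"
    and disj: "\<And>i j t. \<lbrakk>i < k; j < k; t \<in> J (real i / k) (real i / k + s);
      t \<in> J (real j / k) (real j / k + s)\<rbrakk> \<Longrightarrow> i = j"
  shows "P_opt J l r n A \<le> (\<Sum>i=1..n. A i) / (k * s) + A_max n A / s"
proof -
  have "0 < s" using \<open>0 < l\<close> s by linarith
  have A_le: "A i \<le> A_max n A" if "i \<in> {1..n}" for i
    unfolding A_max_def using that by (intro Max_ge) auto
  have "0 \<le> A_max n A"
    using A[of 1] A_le[of 1] \<open>1 \<le> n\<close> by auto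
  moreover have "0 \<le> A i" if "i \<in> {1..n}" for i
    using A[OF that] by simp
  ultimately obtain f where f: "\<forall>i\<in>{1..n}. f i < k"
    and load: "\<forall>j<k. (\<Sum>i\<in>{i\<in>{1..n}. f i = j}. A i) \<le> (\<Sum>i=1..n. A i) / k + A_max n A"
    using greedy_balanced_partition[of "{1..n}" k "A_max n A" A] \<open>0 < k\<close> A_le by auto
  define B where "B = ((\<Sum>i=1..n. A i) / k + A_max n A) / s"
  define \<pi> where "\<pi> i = (real (f i) / k, s)" for i
  have "\<pi> \<in> policies l r n"
  proof -
    have "real (f i) / k + s \<le> 1" if "i \<in> {1..n}" for i
    proof -
      have "real (f i) + 1 \<le> k"
        using f that by fastforce
      then have "(real (f i) + 1) / k \<le> 1"
        using \<open>0 < k\<close> by simp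
      then show ?thesis
        using k by (simp add: add_divide_distrib)
    qed
    then show ?thesis
      using \<open>0 < s\<close> s by (auto simp: policies_def \<pi>_def)
  qed
  moreover have "total_power J n A \<pi> t \<le> B" for t
  \<comment> \<open>If \<open>t\<close> lies in a slot, that slot is unique by \<open>disj\<close>
    and exactly its jobs contribute; otherwise no job is running.\<close>
  proof (cases "\<exists>j<k. t \<in> J (real j / k) (real j / k + s)")
    case True
    then obtain j where j: "j < k" "t \<in> J (real j / k) (real j / k + s)"
      by blast
    have "total_power J n A \<pi> t = (\<Sum>i=1..n. if f i = j then A i / s else 0)"
      unfolding total_power_def \<pi>_def
      using f j disj by (intro sum.cong) (auto simp: indicator_def)
    also have "\<dots> = (\<Sum>i\<in>{i\<in>{1..n}. f i = j}. A i) / s"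
      by (subst sum.inter_filter[symmetric]) (simp_all add: sum_divide_distrib)
    also have "\<dots> \<le> B"
      unfolding B_def using load j \<open>0 < s\<close> by (intro divide_right_mono) auto
    finally show ?thesis .
  next
    case False
    then have "total_power J n A \<pi> t = 0"
      unfolding total_power_def \<pi>_def using f by (intro sum.neutral) auto
    moreover have "0 \<le> B"
      unfolding B_def using \<open>0 \<le> A_max n A\<close> \<open>0 < s\<close> sum_nonneg[of "{1..n}" A] A
      by (simp add: less_imp_le)
    ultimately show ?thesis by simp
  qed
  then have "peak_power J n A \<pi> \<le> B"
    unfolding peak_power_def by (subst Max_le_iff) (auto simp: finite_total_power_image)
  ultimately have "P_opt J l r n A \<le> B"
    unfolding P_opt_def by (intro cINF_lower2 bdd_below_peak_power \<open>0 < l\<close> A)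
  also have "B = (\<Sum>i=1..n. A i) / (k * s) + A_max n A / s"
    by (simp add: B_def add_divide_distrib)
  finally show ?thesis .
qed

text \<open>Half-open slots may abut, so \<open>s = 1 / k\<close> is allowed. A common instant of
  slots \<open>i\<close> and \<open>j\<close> forces the two integers to differ by less than
  1.\<close>

lemma P_opt_Ico_le_slots:
  fixes k :: nat and s :: real
  assumes "0 < l" "1 \<le> n" "\<And>i. i \<in> {1..n} \<Longrightarrow> 0 < A i"
    and k: "0 < k" "s \<le> 1 / k" and "l \<le> s" "s \<le> r"
  shows "P_opt atLeastLessThan l r n A \<le> (\<Sum>i=1..n. A i) / (k * s) + A_max n A / s"
proof (rule P_opt_le_slots[OF assms])
  fix i j t
  assume "t \<in> {real i / k..<real i / k + s}" "t \<in> {real j / k..<real j / k + s}"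
  with k have "real i / k < (real j + 1) / k" "real j / k < (real i + 1) / k"
    unfolding add_divide_distrib by auto
  then have "real i < real j + 1" "real j < real i + 1"
    using k by (simp_all add: divide_less_cancel)
  then show "i = j" by linarith
qed

lemma P_opt_Icc_le_slots:
  fixes k :: nat and s :: real
  assumes "0 < l" "1 \<le> n" "\<And>i. i \<in> {1..n} \<Longrightarrow> 0 < A i"
    and k: "0 < k" "s < 1 / k" and "l \<le> s" "s \<le> r"
  shows "P_opt atLeastAtMost l r n A \<le> (\<Sum>i=1..n. A i) / (k * s) + A_max n A / s"
proof (rule P_opt_le_slots[OF assms(1-4) less_imp_le[OF k(2)] assms(6,7)])
  fix i j t
  assume "t \<in> {real i / k..real i / k + s}" "t \<in> {real j / k..real j / k + s}"
  with k have "real i / k < (real j + 1) / k" "real j / k < (real i + 1) / k"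
    unfolding add_divide_distrib by auto
  then have "real i < real j + 1" "real j < real i + 1"
    using k by (simp_all add: divide_less_cancel)
  then show "i = j" by linarith
qed

section \<open>Lower bounds by averaging the power\<close>

text \<open>Adding the right endpoint can only raise the power at each instant. Hence a lower bound
  proved for half-open intervals carries over to closed ones.\<close>

lemma P_opt_Ico_le_Icc:
  assumes "0 < l" "l \<le> r" "r \<le> 1" and A: "\<And>i. i \<in> {1..n} \<Longrightarrow> 0 < A i"
  shows "P_opt atLeastLessThan l r n A \<le> P_opt atLeastAtMost l r n A"
  unfolding P_opt_def
proof (rule cINF_mono[OF policies_nonempty[OF assms(1-3)] bdd_below_peak_power[OF \<open>0 < l\<close> A]])
  fix \<pi> assume \<pi>: "\<pi> \<in> policies l r n"
  have "total_power atLeastLessThan n A \<pi> t \<le> total_power atLeastAtMost n A \<pi> t" for t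
    unfolding total_power_def
  proof (rule sum_mono)
    fix i assume i: "i \<in> {1..n}"
    show "(case \<pi> i of (\<tau>, s) \<Rightarrow> A i / s * indicator {\<tau>..<\<tau> + s} t)
      \<le> (case \<pi> i of (\<tau>, s) \<Rightarrow> A i / s * indicator {\<tau>..\<tau> + s} t)"
      using policiesD[OF \<pi> i] A[OF i] \<open>0 < l\<close> by (auto simp: case_prod_unfold indicator_def)
  qed
  then have "total_power atLeastLessThan n A \<pi> t \<le> peak_power atLeastAtMost n A \<pi>"
    if "0 \<le> t" "t \<le> 1" for t
    using total_power_le_peak_power[OF that] order_trans by blast
  then have "peak_power atLeastLessThan n A \<pi> \<le> peak_power atLeastAtMost n A \<pi>"
    unfolding peak_power_def[of atLeastLessThan]
    by (subst Max_le_iff) (auto simp: finite_total_power_image)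
  with \<pi> show "\<exists>\<pi>'\<in>policies l r n. peak_power atLeastLessThan n A \<pi>' \<le> peak_power atLeastAtMost n A \<pi>"
    by blast
qed

lemma total_power_has_integral:
  assumes "0 < l" and \<pi>: "\<pi> \<in> policies l r n"
  shows "(total_power atLeastLessThan n A \<pi> has_integral (\<Sum>i=1..n. A i)) {0..1}"
  unfolding total_power_def
proof (rule has_integral_sum)
  fix i assume i: "i \<in> {1..n}"
  obtain \<tau> s where \<pi>i: "\<pi> i = (\<tau>, s)" by fastforce
  have \<tau>: "0 \<le> \<tau>" "\<tau> + s \<le> 1" and "0 < s"
    using policiesD[OF \<pi> i] \<open>0 < l\<close> by (auto simp: \<pi>i)
  have "((\<lambda>t. A i / s) has_integral A i) {\<tau>..\<tau> + s}"
    using has_integral_const_real[of "A i / s" \<tau> "\<tau> + s"] \<open>0 < s\<close> by simp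
  then have "((\<lambda>t. if t \<in> {\<tau>..\<tau> + s} then A i / s else 0) has_integral A i) {0..1}"
    using \<tau> by (subst has_integral_restrict) auto
  \<comment> \<open>Dropping the right endpoint changes the integrand on a null set only.\<close>
  then have "((\<lambda>t. A i / s * indicator {\<tau>..<\<tau> + s} t) has_integral A i) {0..1}"
    by (rule has_integral_spike[of "{\<tau> + s}", rotated 2]) (auto simp: indicator_def)
  then show "((\<lambda>t. case \<pi> i of (\<tau>, s) \<Rightarrow> A i / s * indicator {\<tau>..<\<tau> + s} t) has_integral A i) {0..1}"
    by (simp add: \<pi>i)
qed simp

lemma sum_le_peak_power:
  assumes "0 < l" "\<pi> \<in> policies l r n"
  shows "(\<Sum>i=1..n. A i) \<le> peak_power atLeastLessThan n A \<pi>"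
proof -
  have "((\<lambda>t. peak_power atLeastLessThan n A \<pi>) has_integral peak_power atLeastLessThan n A \<pi>) {0..1::real}"
    using has_integral_const_real[of "peak_power atLeastLessThan n A \<pi>" 0 1] by simp
  from has_integral_le[OF total_power_has_integral[OF assms] this] show ?thesis
    by (auto intro: total_power_le_peak_power)
qed

lemma Ico_meets_grid:
  fixes m :: nat and \<tau> s :: real
  assumes "0 \<le> \<tau>" "\<tau> + s \<le> 1" "1 / (m + 1) < s"
  shows "\<exists>j\<in>{1..m}. real j / (m + 1) \<in> {\<tau>..<\<tau> + s}"
proof -
  \<comment> \<open>The first grid point strictly after \<open>\<tau>\<close>. A ceiling would give
    the index 0 when \<open>\<tau> = 0\<close>, which is outside \<open>{1..m}\<close>.\<close>
  define j where "j = nat (\<lfloor>\<tau> * (m + 1)\<rfloor> + 1)"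
  have "0 \<le> \<lfloor>\<tau> * (m + 1)\<rfloor>"
    using assms(1) by simp
  then have j: "1 \<le> j" "\<tau> * (m + 1) < real j" "real j \<le> \<tau> * (m + 1) + 1"
    unfolding j_def by linarith+
  have s: "1 < s * (m + 1)"
    using assms(3) by (simp add: divide_less_eq)
  have "real j < \<tau> * (m + 1) + s * (m + 1)"
    using j(3) s by linarith
  also have "\<dots> = (\<tau> + s) * (m + 1)"
    by (simp add: algebra_simps)
  finally have less: "real j < (\<tau> + s) * (m + 1)" .
  \<comment> \<open>The job ends by time 1, and the grid point lies strictly before its end; this
    excludes \<open>j = m + 1\<close>.\<close>
  also have "\<dots> \<le> 1 * real (m + 1)"
    using assms(2) by (intro mult_right_mono) auto
  finally have "j \<le> m"
    by simp
  moreover have "real j / (m + 1) \<in> {\<tau>..<\<tau> + s}"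
    using j(2) less by (auto simp: divide_less_eq le_divide_eq)
  ultimately show ?thesis
    using j(1) by auto
qed

text \<open>Double counting over jobs and grid times: each job is hit at least once, and then
  contributes \<open>A i / s\<close>, which is at least \<open>A i / r\<close>.\<close>

lemma sum_le_peak_power_grid:
  fixes m :: nat
  assumes "0 < l" "1 / (m + 1) < l" and A: "\<And>i. i \<in> {1..n} \<Longrightarrow> 0 < A i"
    and \<pi>: "\<pi> \<in> policies l r n"
  shows "(\<Sum>i=1..n. A i) / r \<le> m * peak_power atLeastLessThan n A \<pi>"
proof -
  let ?t = "\<lambda>j. real j / (m + 1)"
  let ?J = "\<lambda>i. {fst (\<pi> i)..<fst (\<pi> i) + snd (\<pi> i)}"
  have job: "A i / r \<le> (\<Sum>j=1..m. A i / snd (\<pi> i) * indicator (?J i) (?t j))" if i: "i \<in> {1..n}" for i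
  proof -
    note \<pi>i = policiesD[OF \<pi> i]
    obtain j where j: "j \<in> {1..m}" "?t j \<in> ?J i"
      using Ico_meets_grid[of "fst (\<pi> i)" "snd (\<pi> i)" m] \<pi>i assms(2) by auto
    have "A i / r \<le> A i / snd (\<pi> i) * indicator (?J i) (?t j)"
      using j \<pi>i A[OF i] \<open>0 < l\<close> by (simp add: frac_le)
    also have "\<dots> \<le> (\<Sum>j=1..m. A i / snd (\<pi> i) * indicator (?J i) (?t j))"
      using A[OF i] \<pi>i \<open>0 < l\<close> by (intro member_le_sum[OF j(1)]) auto
    finally show ?thesis .
  qed
  have "(\<Sum>i=1..n. A i) / r \<le> (\<Sum>i=1..n. \<Sum>j=1..m. A i / snd (\<pi> i) * indicator (?J i) (?t j))"
    unfolding sum_divide_distrib by (intro sum_mono job)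
  also have "\<dots> = (\<Sum>j=1..m. total_power atLeastLessThan n A \<pi> (?t j))"
    unfolding total_power_def case_prod_unfold by (rule sum.swap)
  also have "\<dots> \<le> (\<Sum>j=1..m. peak_power atLeastLessThan n A \<pi>)"
    by (intro sum_mono total_power_le_peak_power) auto
  also have "\<dots> = m * peak_power atLeastLessThan n A \<pi>"
    by simp
  finally show ?thesis .
qed

section \<open>Integer slot counts inside and outside the good region\<close>

text \<open>Outside the good region \<open>1 / r\<close> cannot be an integer, since it would equal
  its ceiling and be at most \<open>1 / l\<close>. So \<open>m\<close>, the floor of
  \<open>1 / r\<close>, is strictly below it, and the ceiling is at most \<open>m + 1\<close>, which
  yields the bound on \<open>l\<close>.\<close>

lemma not_good_region_floor:
  fixes l r :: real
  assumes "0 < l" "l \<le> r" "r \<le> 1" "(l, r) \<notin> good_region"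
  obtains m :: nat where "0 < m" "r < 1 / m" "1 / (m + 1) < l" "Z_star r = m * r"
proof
  define m where "m = nat \<lfloor>1 / r\<rfloor>"
  have "0 < r" using assms by linarith
  then have "1 \<le> 1 / r" using assms by simp
  then have "1 \<le> \<lfloor>1 / r\<rfloor>" by simp
  then have m: "real m = of_int \<lfloor>1 / r\<rfloor>"
    unfolding m_def by (intro of_nat_nat) linarith
  with \<open>1 \<le> \<lfloor>1 / r\<rfloor>\<close> show "0 < m"
    by linarith
  show "Z_star r = m * r"
    by (simp add: m Z_star_def)
  have bad: "1 / l < of_int \<lceil>1 / r\<rceil>"
    using assms(4) by (simp add: good_region_def)
  have "1 / r \<le> 1 / l"
    using assms by (simp add: frac_le)
  with bad have "1 / r < of_int \<lceil>1 / r\<rceil>" by linarith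
  then have less: "real m < 1 / r"
    unfolding m by (metis ceiling_of_int less_irrefl of_int_floor_le order_le_less)
  then show "r < 1 / m"
    using \<open>0 < r\<close> \<open>0 < m\<close> by (simp add: field_simps)
  have "\<lceil>1 / r\<rceil> \<le> \<lfloor>1 / r\<rfloor> + 1"
    by linarith
  then have "1 / l < real m + 1"
    using bad m by linarith
  then show "1 / (m + 1) < l"
    using \<open>0 < l\<close> by (simp add: field_simps)
qed

text \<open>The good region provides a slot length \<open>1 / k\<close> that is itself an admissible
  job length. The last conclusion identifies \<open>k\<close>, so that the boundary case
  \<open>l = 1 / k\<close> can be recognized later.\<close>

lemma good_region_ceiling:
  fixes l r :: real
  assumes "0 < l" "l \<le> r" "(l, r) \<in> good_region"
  obtains k :: nat where "0 < k" "1 / k \<le> r" "l \<le> 1 / k" "real k = of_int \<lceil>1 / r\<rceil>"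
proof
  define k where "k = nat \<lceil>1 / r\<rceil>"
  have "0 < 1 / r" using assms by simp
  then have "0 < \<lceil>1 / r\<rceil>" by simp
  then show "0 < k" and k: "real k = of_int \<lceil>1 / r\<rceil>"
    by (auto simp: k_def)
  have "1 / r \<le> k" "k \<le> 1 / l"
    using assms(3) unfolding k by (auto simp: good_region_def)
  then show "1 / k \<le> r" "l \<le> 1 / k"
    using assms \<open>0 < k\<close> by (auto simp: field_simps)
qed

section \<open>The two-sided bound\<close>

lemma A_bar_le_P_opt:
  assumes lr: "0 < l" "l \<le> r" "r \<le> 1" and A: "\<And>i. i \<in> {1..n} \<Longrightarrow> 0 < A i"
  shows "A_bar l r n A \<le> P_opt atLeastLessThan l r n A"
  unfolding P_opt_def
proof (rule cINF_greatest[OF policies_nonempty[OF lr]])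
  fix \<pi> assume \<pi>: "\<pi> \<in> policies l r n"
  show "A_bar l r n A \<le> peak_power atLeastLessThan n A \<pi>"
  proof (cases "(l, r) \<in> good_region")
    case True
    then show ?thesis
      using sum_le_peak_power[OF \<open>0 < l\<close> \<pi>] by (simp add: A_bar_def)
  next
    case False
    then obtain m :: nat where m: "0 < m" "1 / (m + 1) < l" "Z_star r = m * r"
      using not_good_region_floor[OF lr] by metis
    have "(\<Sum>i=1..n. A i) / r \<le> m * peak_power atLeastLessThan n A \<pi>"
      by (intro sum_le_peak_power_grid[OF \<open>0 < l\<close> m(2) _ \<pi>] A)
    then have "(\<Sum>i=1..n. A i) / r / m \<le> peak_power atLeastLessThan n A \<pi>"
      using \<open>0 < m\<close> by (subst divide_le_eq) (simp add: mult.commute)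
    then show ?thesis
      using False m by (simp add: A_bar_def mult.commute)
  qed
qed

lemma A_max_pos:
  assumes "1 \<le> n" "\<And>i. i \<in> {1..n} \<Longrightarrow> 0 < A i"
  shows "0 < A_max n A"
  unfolding A_max_def using assms by (subst Max_gr_iff) auto

lemma P_opt_Ico_le:
  assumes lr: "0 < l" "l \<le> r" "r \<le> 1" and n: "1 \<le> n" and A: "\<And>i. i \<in> {1..n} \<Longrightarrow> 0 < A i"
  shows "P_opt atLeastLessThan l r n A \<le> A_bar l r n A + A_max n A / l"
proof -
  have M: "A_max n A / s \<le> A_max n A / l" if "l \<le> s" for s
    using A_max_pos[of n A] n A that \<open>0 < l\<close> by (intro frac_le) auto
  show ?thesis
  proof (cases "(l, r) \<in> good_region")
    case True
    then obtain k :: nat where k: "0 < k" "1 / k \<le> r" "l \<le> 1 / k"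
      using good_region_ceiling[OF lr(1,2)] by metis
    then have "P_opt atLeastLessThan l r n A \<le> (\<Sum>i=1..n. A i) / (k * (1 / k)) + A_max n A / (1 / k)"
      by (intro P_opt_Ico_le_slots \<open>0 < l\<close> n A) auto
    then show ?thesis
      using True k M[OF k(3)] by (simp add: A_bar_def)
  next
    case False
    then obtain m :: nat where m: "0 < m" "r < 1 / m" "Z_star r = m * r"
      using not_good_region_floor[OF lr] by metis
    \<comment> \<open>The longest admissible jobs fit into \<open>m\<close> slots, and
      \<open>m * r\<close> is exactly \<open>Z_star r\<close>.\<close>
    have "P_opt atLeastLessThan l r n A \<le> (\<Sum>i=1..n. A i) / (m * r) + A_max n A / r"
      using m lr by (intro P_opt_Ico_le_slots n A) auto
    then show ?thesis
      using False m M[OF \<open>l \<le> r\<close>] by (simp add: A_bar_def)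
  qed
qed

lemma P_opt_Icc_le:
  assumes lr: "0 < l" "l \<le> r" "r \<le> 1" and n: "1 \<le> n" and A: "\<And>i. i \<in> {1..n} \<Longrightarrow> 0 < A i"
    and "1 / l \<noteq> real_of_int \<lceil>1 / r\<rceil>"
  shows "P_opt atLeastAtMost l r n A \<le> A_bar l r n A + A_max n A / l"
proof -
  have M: "A_max n A / s \<le> A_max n A / l" if "l \<le> s" for s
    using A_max_pos[of n A] n A that \<open>0 < l\<close> by (intro frac_le) auto
  show ?thesis
  proof (cases "(l, r) \<in> good_region")
    case True
    then obtain k :: nat where k: "0 < k" "1 / k \<le> r" "l \<le> 1 / k" "real k = of_int \<lceil>1 / r\<rceil>"
      using good_region_ceiling[OF lr(1,2)] by metis
    \<comment> \<open>The excluded equality is what leaves room for job lengths strictly between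
      \<open>l\<close> and \<open>1 / k\<close>.\<close>
    have "l \<noteq> 1 / k"
      using assms(6) k by auto
    with k have "l < 1 / k" by simp
    let ?F = "\<lambda>s::real. (\<Sum>i=1..n. A i) / (k * s) + A_max n A / s"
    \<comment> \<open>Closed slots of length \<open>1 / k\<close> would touch, so the bound at
      \<open>1 / k\<close> is reached as a left limit of the bounds for shorter jobs.\<close>
    have "(?F \<longlongrightarrow> ?F (1 / k)) (at_left (1 / k))"
      using k by (intro tendsto_intros) auto
    moreover have "\<forall>\<^sub>F s in at_left (1 / k). P_opt atLeastAtMost l r n A \<le> ?F s"
      using eventually_at_left_real[OF \<open>l < 1 / k\<close>]
    proof eventually_elim
      case (elim s)
      then show ?case
        using k by (intro P_opt_Icc_le_slots \<open>0 < l\<close> n A) auto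
    qed
    ultimately have "P_opt atLeastAtMost l r n A \<le> ?F (1 / k)"
      by (intro tendsto_lowerbound) auto
    then show ?thesis
      using True k M[OF k(3)] by (simp add: A_bar_def)
  next
    case False
    then obtain m :: nat where m: "0 < m" "r < 1 / m" "Z_star r = m * r"
      using not_good_region_floor[OF lr] by metis
    have "P_opt atLeastAtMost l r n A \<le> (\<Sum>i=1..n. A i) / (m * r) + A_max n A / r"
      using m lr by (intro P_opt_Icc_le_slots n A) auto
    then show ?thesis
      using False m M[OF \<open>l \<le> r\<close>] by (simp add: A_bar_def)
  qed
qed

theorem theorem1:
  fixes l r :: real and n :: nat and A :: "nat \<Rightarrow> real"
  assumes "0 < l" and "l \<le> r" and "r \<le> 1"
    and "n \<ge> 1"
    and "\<And>i. i \<in> {1..n} \<Longrightarrow> 0 < A i"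
  shows "(A_bar l r n A \<le> P_opt atLeastAtMost l r n A
        \<and> (1 / l \<noteq> real_of_int \<lceil>1 / r\<rceil>
             \<longrightarrow> P_opt atLeastAtMost l r n A \<le> A_bar l r n A + A_max n A / l))
    \<and> (A_bar l r n A \<le> P_opt atLeastLessThan l r n A
        \<and> P_opt atLeastLessThan l r n A \<le> A_bar l r n A + A_max n A / l)"
proof (intro conjI impI)
  show Ico: "A_bar l r n A \<le> P_opt atLeastLessThan l r n A"
    using assms by (intro A_bar_le_P_opt)
  also have "\<dots> \<le> P_opt atLeastAtMost l r n A"
    using assms by (intro P_opt_Ico_le_Icc)
  finally show "A_bar l r n A \<le> P_opt atLeastAtMost l r n A" .
  show "P_opt atLeastLessThan l r n A \<le> A_bar l r n A + A_max n A / l"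
    using assms by (intro P_opt_Ico_le)
  show "P_opt atLeastAtMost l r n A \<le> A_bar l r n A + A_max n A / l"
    if "1 / l \<noteq> real_of_int \<lceil>1 / r\<rceil>"
    using assms that by (intro P_opt_Icc_le)
qed

end
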